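(* Let $m$ be a positive integer. For all integers $n,k\ge0$ we have \[ \mathrm{pc}_+^k(n,m)=\sum_{2i+mj+(m-1)r+s=n-k}(-1)^r2^i\binom{i}{k}\binom{i+j-1}{j}\binom{k}{r}\binom{k+s-1}{s} \] and \[ \mathrm{pc}_+^k(n,m)=\sum_{\substack{i_0+i_1+\cdots+i_{m-2}=k\\ 2i+mj+i_1+2i_2+\cdots+(m-2)i_{m-2}=n-k}}2^i\binom{i}{k}\binom{i+j-1}{j}\binom{k}{i_0,i_1,\ldots,i_{m-2}}. \]
   Context: A composition of $n$ is a finite sequence $\alpha=(\alpha_1,\ldots,\alpha_\ell)$ of positive integers with $\alpha_1+\cdots+\alpha_\ell=n$; the empty sequence ($\ell=0$) is the only composition of $0$. $\mathrm{pc}_+^k(n,m)$ is the number of compositions $\alpha=(\alpha_1,\ldots,\alpha_\ell)$ of $n$ such that $\#\{1\le i\le \ell/2:\alpha_i\not\equiv\alpha_{\ell+1-i}\pmod m\}=k$ and either $\ell$ is even, or $\ell$ is odd and the middle part $\alpha_{(\ell+1)/2}$ is even. Convention for binomial coefficients, for integers $a,b$: $\binom{a}{b}=\frac{a!}{b!(a-b)!}$ if $a\ge b\ge1$; $\binom{a}{b}=1$ if $b=0$ (for every integer $a$, including $a=-1$); $\binom{a}{b}=0$ otherwise. $\binom{k}{i_0,\ldots,i_{m-2}}=\frac{k!}{i_0!\cdots i_{m-2}!}$ is the multinomial coefficient. All summation indices (including $i_0,\ldots,i_{m-2}$) range over nonnegative integers; only finitely many terms are nonzero. When $m=1$ the list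 $i_0,\ldots,i_{m-2}$ is empty with empty sum $0$, so the second sum is empty unless $k=0$, in which case the multinomial coefficient is $1$. *)

theory Defs
  imports "HOL-Number_Theory.Cong"
begin

definition compositions :: "nat \<Rightarrow> nat list set" where
  "compositions n = {\<alpha>. (\<forall>a\<in>set \<alpha>. 0 < a) \<and> sum_list \<alpha> = n}"

(* Positions i are 1-based, lists are 0-based: the i-th part is \<alpha> ! (i - 1) and the
   (length \<alpha> + 1 - i)-th part is \<alpha> ! (length \<alpha> - i). *)
definition mismatches :: "nat \<Rightarrow> nat list \<Rightarrow> nat set" where
  "mismatches m \<alpha> =
     {i. 1 \<le> i \<and> 2 * i \<le> length \<alpha> \<and> \<not> [\<alpha> ! (i - 1) = \<alpha> ! (length \<alpha> - i)] (mod m)}"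

definition pc_plus :: "nat \<Rightarrow> nat \<Rightarrow> nat \<Rightarrow> nat" where
  "pc_plus k n m =
     card {\<alpha> \<in> compositions n. card (mismatches m \<alpha>) = k \<and>
       (even (length \<alpha>) \<or> (odd (length \<alpha>) \<and> even (\<alpha> ! ((length \<alpha> + 1) div 2 - 1))))}"

(* The gchoose of the library differs from this convention for negative upper argument. *)
definition binom :: "int \<Rightarrow> int \<Rightarrow> int" where
  "binom a b =
     (if b = 0 then 1 else if 1 \<le> b \<and> b \<le> a then int (nat a choose nat b) else 0)"

(* The division is exact whenever the entries of is sum to k. *)
definition multinomial :: "nat \<Rightarrow> nat list \<Rightarrow> nat" where
  "multinomial k is = fact k div prod_list (map fact is)"

(* The statement uses sum' of HOL.Groups_Big, the sum over the nonzero terms only: for m = 1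
   the index set of the first sum is infinite, r being bounded only by the factor binom k r. *)

end

theory Submission
  imports Defs "HOL-Computational_Algebra.Formal_Power_Series"
begin

text \<open>Remove the first and the last part repeatedly from a composition whose middle part, if there is one,
is even: it becomes a sequence of pairs around a core that is empty or a single even part. Let \<open>E = 1 / (1 - X^2)\<close>, and let \<open>M\<close> and \<open>N\<close> be
the generating functions, by sum, of the pairs of positive integers that are congruent or
incongruent modulo \<open>m\<close>. The cores have generating function \<open>E\<close>, so the generating functions \<open>F k\<close> of
\<open>pc_plus k n m\<close> satisfy

  \<open>F 0 = E + M F 0\<close> and \<open>F (k + 1) = M F (k + 1) + N F k\<close>.

A pair is determined by its minimum and its signed difference, so both \<open>M\<close> and \<open>N\<close> contain the
factor \<open>X^2 E\<close> for the minimum. The differences divisible by \<open>m\<close> contribute \<open>2 / (1 - X^m) - 1\<close>, the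
others \<open>2 / (1 - X) - 2 / (1 - X^m)\<close>. With \<open>b = 2 X^2 / (1 - X^m)\<close> and \<open>H = 1 + X + \<dots> + X^(m - 2)\<close> this
gives \<open>1 - M = E (1 - b)\<close> and \<open>N = E b X H\<close>. The factor \<open>E\<close> cancels, and

  \<open>F k = X^k H^k b^k / (1 - b)^(k + 1)\<close>,

which is \<open>X^k H^k\<close> times the sum of \<open>(i choose k) b^i\<close> over all \<open>i\<close> (\<open>pc_series_closed_form\<close>).

The powers \<open>b^i\<close> produce the sum over \<open>i\<close> and \<open>j\<close>, and \<open>X^k\<close> the shift from \<open>n\<close> to \<open>n - k\<close>. Finally
\<open>H^k\<close> is expanded in two ways: as \<open>(1 - X^(m - 1))^k (1 - X)^(- k)\<close>, which gives the first formula,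
and by the multinomial theorem, which gives the second (\<open>pc_plus_eq_sum\<close>).\<close>

unbundle fps_syntax

section \<open>Series as formal sums over weighted index sets\<close>

text \<open>The series \<^term>\<open>f\<close> is the formal sum of the terms \<open>c x * X ^ w x\<close> for \<open>x \<in> S\<close>. Only the terms
with \<open>c x \<noteq> 0\<close> are asked to be finitely many in each degree: in the first formula with \<open>m = 1\<close> the
index \<open>r\<close> does not affect the degree and is bounded by the vanishing of the binomial coefficient
alone. With \<open>c = 1\<close> this says that \<^term>\<open>f\<close> is the generating function of \<open>S\<close> by weight.\<close>
definition expansion :: "'a::comm_ring_1 fps \<Rightarrow> 'b set \<Rightarrow> ('b \<Rightarrow> 'a) \<Rightarrow> ('b \<Rightarrow> nat) \<Rightarrow> bool" where
  "expansion f S c w \<longleftrightarrow>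
     (\<forall>n. finite {x \<in> S. w x = n \<and> c x \<noteq> 0} \<and> f $ n = (\<Sum>x | x \<in> S \<and> w x = n \<and> c x \<noteq> 0. c x))"

text \<open>Any finite set between the support of \<open>c\<close> in degree \<open>n\<close> and the whole fibre of \<open>w\<close> over \<open>n\<close> may
serve to compute the coefficient, because the additional terms are zero.\<close>
lemma expansionI:
  assumes "\<And>n. finite (T n)"
    and "\<And>n x. x \<in> S \<Longrightarrow> w x = n \<Longrightarrow> c x \<noteq> 0 \<Longrightarrow> x \<in> T n"
    and "\<And>n x. x \<in> T n \<Longrightarrow> x \<in> S \<and> w x = n"
    and "\<And>n. f $ n = (\<Sum>x\<in>T n. c x)"
  shows "expansion f S c w"
  unfolding expansion_def
proof (intro allI conjI)
  fix n
  have sub: "{x \<in> S. w x = n \<and> c x \<noteq> 0} \<subseteq> T n"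
    using assms(2) by auto
  then show "finite {x \<in> S. w x = n \<and> c x \<noteq> 0}"
    using assms(1) finite_subset by blast
  have "(\<Sum>x\<in>T n. c x) = (\<Sum>x | x \<in> S \<and> w x = n \<and> c x \<noteq> 0. c x)"
    using assms(1,3) sub by (intro sum.mono_neutral_right) auto
  then show "f $ n = (\<Sum>x | x \<in> S \<and> w x = n \<and> c x \<noteq> 0. c x)"
    using assms(4) by simp
qed

lemma expansion_unique:
  "expansion f S c w \<Longrightarrow> expansion g S c w \<Longrightarrow> f = g"
  unfolding expansion_def by (simp add: fps_eq_iff)

lemma expansion_nth:
  assumes "expansion f S c w"
  shows "sum' c {x \<in> S. w x = n} = f $ n"
  using assms unfolding expansion_def sum.G_def by (simp add: conj_assoc)

lemma expansion_image:
  assumes f: "expansion f S c w" and inj: "inj_on h S"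
    and cw: "\<And>x. x \<in> S \<Longrightarrow> c' (h x) = c x \<and> w' (h x) = w x"
  shows "expansion f (h ` S) c' w'"
  unfolding expansion_def
proof (intro allI)
  fix n
  let ?T = "{x \<in> S. w x = n \<and> c x \<noteq> 0}"
  have eq: "{y \<in> h ` S. w' y = n \<and> c' y \<noteq> 0} = h ` ?T"
    using cw by auto
  have "sum c' (h ` ?T) = sum c ?T"
    using inj cw by (subst sum.reindex) (auto simp: inj_on_def intro!: sum.cong)
  then show "finite {y \<in> h ` S. w' y = n \<and> c' y \<noteq> 0} \<and>
      f $ n = (\<Sum>y | y \<in> h ` S \<and> w' y = n \<and> c' y \<noteq> 0. c' y)"
    using f unfolding eq expansion_def by simp
qed

lemma expansion_Un:
  assumes f: "expansion f S c w" and g: "expansion g T c w" and disj: "S \<inter> T = {}"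
  shows "expansion (f + g) (S \<union> T) c w"
proof (rule expansionI)
  fix n
  let ?S = "{x \<in> S. w x = n \<and> c x \<noteq> 0}" and ?T = "{x \<in> T. w x = n \<and> c x \<noteq> 0}"
  show "finite (?S \<union> ?T)"
    using f g by (simp add: expansion_def)
  show "(f + g) $ n = sum c (?S \<union> ?T)"
    using f g disj by (subst sum.union_disjoint) (auto simp: expansion_def)
qed auto

text \<open>The support of the product in degree \<open>n\<close> is contained in the disjoint union, over all ways of
splitting \<open>n\<close>, of the products of the two supports; summing over that union is the Cauchy product.\<close>
lemma expansion_mult:
  assumes f: "expansion f S c w" and g: "expansion g T d v"
  shows "expansion (f * g) (S \<times> T) (\<lambda>(x, y). c x * d y) (\<lambda>(x, y). w x + v y)"
proof -
  define A where "A n = {x \<in> S. w x = n \<and> c x \<noteq> 0}" for n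
  define B where "B n = {y \<in> T. v y = n \<and> d y \<noteq> 0}" for n
  have fin: "finite (A n)" "finite (B n)" for n
    using f g unfolding A_def B_def expansion_def by auto
  show ?thesis
  proof (rule expansionI[where T = "\<lambda>n. \<Union>i\<in>{0..n}. A i \<times> B (n - i)"])
    fix n
    show "finite (\<Union>i\<in>{0..n}. A i \<times> B (n - i))"
      using fin by auto
    have "(\<Sum>z\<in>(\<Union>i\<in>{0..n}. A i \<times> B (n - i)). case z of (x, y) \<Rightarrow> c x * d y)
        = (\<Sum>i=0..n. \<Sum>z\<in>A i \<times> B (n - i). case z of (x, y) \<Rightarrow> c x * d y)"
      using fin by (intro sum.UNION_disjoint) (auto simp: A_def)
    also have "\<dots> = (\<Sum>i=0..n. f $ i * g $ (n - i))"
      using f g by (intro sum.cong refl)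
        (simp add: expansion_def A_def B_def sum_product sum.cartesian_product)
    finally show "(f * g) $ n = (\<Sum>z\<in>(\<Union>i\<in>{0..n}. A i \<times> B (n - i)). case z of (x, y) \<Rightarrow> c x * d y)"
      by (simp add: fps_mult_nth)
  qed (auto simp: A_def B_def)
qed

lemma expansion_X_power: "expansion (fps_X ^ k) {()} (\<lambda>_. 1) (\<lambda>_. k)"
  by (rule expansionI[where T = "\<lambda>n. if n = k then {()} else {}"]) (auto split: if_splits)

section \<open>Geometric and binomial series\<close>

text \<open>The series \<open>1 / (1 - X ^ m)\<close>. Working with it instead of a quotient keeps all coefficients integers.\<close>
definition geo :: "nat \<Rightarrow> int fps" where
  "geo m = Abs_fps (\<lambda>n. if m dvd n then 1 else 0)"

lemma geo_inverse:
  assumes "0 < m"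
  shows "(1 - fps_X ^ m) * geo m = 1"
proof (rule fps_ext)
  fix n
  show "((1 - fps_X ^ m) * geo m) $ n = 1 $ n"
    using assms by (auto simp: left_diff_distrib fps_X_power_mult_nth geo_def dvd_imp_le dvd_minus_self)
qed

lemma binom_int_int: "binom (int a) (int b) = int (a choose b)"
  by (auto simp: binom_def)

text \<open>The convention for negative upper arguments is what makes the formula correct at \<open>i = 0\<close>, where
only the term \<open>j = 0\<close> may survive; with it, Pascal's rule holds for all \<open>i\<close> and \<open>j\<close>, and Pascal's
rule is multiplication by \<open>1 - X ^ m\<close>.\<close>
lemma geo_power:
  assumes "0 < m"
  shows "geo m ^ i =
    Abs_fps (\<lambda>n. if m dvd n then binom (int i + int (n div m) - 1) (int (n div m)) else 0)"
    (is "_ = ?B i")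
proof (induction i)
  case 0
  show ?case
  proof (rule fps_ext)
    fix n
    show "(geo m ^ 0) $ n = ?B 0 $ n"
      using assms by (auto simp: binom_def)
  qed
next
  case (Suc i)
  have pascal: "binom (int i + int j) (int j) - (if j = 0 then 0 else binom (int i + int (j - 1)) (int (j - 1)))
      = binom (int i + int j - 1) (int j)" for j
  proof (cases j)
    case 0
    then show ?thesis by (simp add: binom_def)
  next
    case (Suc j')
    have idx: "int i + int j = int (Suc (i + j'))" "int i + int (j - 1) = int (i + j')"
      "int (Suc (i + j')) - 1 = int (i + j')"
      using Suc by simp_all
    show ?thesis
      unfolding idx binom_int_int using Suc by simp
  qed
  have "(1 - fps_X ^ m) * ?B (Suc i) = ?B i"
  proof (rule fps_ext)
    fix n
    show "((1 - fps_X ^ m) * ?B (Suc i)) $ n = ?B i $ n"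
    proof (cases "m dvd n")
      case True
      then obtain j where n: "n = m * j" ..
      then have "n - m = m * (j - 1)" by (simp add: right_diff_distrib')
      moreover have "n < m \<longleftrightarrow> j = 0" using n assms by auto
      ultimately show ?thesis
        using n assms pascal[of j]
        by (cases j) (simp_all add: left_diff_distrib fps_X_power_mult_nth add_ac binom_def[of _ 0])
    next
      case False
      then show ?thesis
        by (auto simp: left_diff_distrib fps_X_power_mult_nth dvd_minus_self)
    qed
  qed
  then have "geo m ^ Suc i = geo m * ((1 - fps_X ^ m) * ?B (Suc i))"
    by (simp only: power_Suc Suc.IH)
  also have "\<dots> = ((1 - fps_X ^ m) * geo m) * ?B (Suc i)"
    by (simp only: mult_ac)
  also have "\<dots> = ?B (Suc i)"
    by (simp only: geo_inverse[OF assms] mult_1_left)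
  finally show ?case .
qed

lemma expansion_geo_power:
  assumes "0 < m"
  shows "expansion (geo m ^ i) UNIV (\<lambda>j. binom (int i + int j - 1) (int j)) (\<lambda>j. m * j)"
  by (rule expansionI[where T = "\<lambda>n. if m dvd n then {n div m} else {}"])
     (use assms in \<open>auto simp: geo_power split: if_splits\<close>)

lemma expansion_one_minus_power:
  "expansion ((1 - fps_X ^ p) ^ k) UNIV (\<lambda>r. (-1) ^ r * binom (int k) (int r)) (\<lambda>r. p * r)"
proof (rule expansionI[where T = "\<lambda>n. {r. r \<le> k \<and> p * r = n}"])
  fix n
  have "(1 - fps_X ^ p) ^ k = (\<Sum>r\<le>k. of_nat (k choose r) * (- (fps_X ^ p)) ^ r :: int fps)"
    using binomial_ring[of "- (fps_X ^ p)" "1 :: int fps" k] by simp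
  also have "\<dots> = (\<Sum>r\<le>k. fps_const ((-1) ^ r * int (k choose r)) * fps_X ^ (p * r))"
    by (intro sum.cong refl)
       (simp add: power_minus[of "fps_X ^ p"] power_mult fps_of_nat[symmetric] 
         flip: fps_const_mult fps_const_power fps_const_neg)
  finally have "((1 - fps_X ^ p) ^ k) $ n = (\<Sum>r\<le>k. if p * r = n then (-1) ^ r * int (k choose r) else 0)"
    by (auto simp: fps_sum_nth intro!: sum.cong)
  also have "\<dots> = (\<Sum>r | r \<le> k \<and> p * r = n. (-1) ^ r * binom (int k) (int r))"
    by (simp add: binom_int_int sum.If_cases Int_def)
  finally show "((1 - fps_X ^ p) ^ k) $ n = (\<Sum>r | r \<le> k \<and> p * r = n. (-1) ^ r * binom (int k) (int r))" .
qed (auto simp: binom_def split: if_splits)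

text \<open>The series \<open>X ^ k / (1 - X) ^ (k + 1)\<close>, as the two lemmas that follow show recursively.\<close>
definition choose_series :: "nat \<Rightarrow> int fps" where
  "choose_series k = Abs_fps (\<lambda>i. int (i choose k))"

lemma choose_series_0: "(1 - fps_X) * choose_series 0 = 1"
  by (rule fps_ext) (auto simp: choose_series_def left_diff_distrib)

lemma choose_series_Suc: "(1 - fps_X) * choose_series (Suc k) = fps_X * choose_series k"
proof (rule fps_ext)
  fix n
  show "((1 - fps_X) * choose_series (Suc k)) $ n = (fps_X * choose_series k) $ n"
    by (cases n) (auto simp: choose_series_def left_diff_distrib)
qed

text \<open>This is the factor \<open>2^i (i choose k) (i + j - 1 choose j)\<close> common to both formulas: put
\<open>b = 2 X^2 / (1 - X^m)\<close> into the sum of \<open>(i choose k) b^i\<close> and expand the power of the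
denominator of \<open>b^i\<close>. Composition is harmless, since \<open>b\<close> has no constant term.\<close>
lemma expansion_choose_series_compose:
  assumes "0 < m"
  shows "expansion (choose_series k oo (2 * fps_X ^ 2 * geo m)) UNIV
     (\<lambda>(i, j). 2 ^ i * binom (int i) (int k) * binom (int i + int j - 1) (int j))
     (\<lambda>(i, j). 2 * i + m * j)"
    (is "expansion _ _ ?c _")
proof (rule expansionI[where T = "\<lambda>n. {(i, j). 2 * i + m * j = n}"])
  fix n
  have le: "j \<le> m * j" for j using assms by simp
  then have sub: "{(i, j). 2 * i + m * j = n} \<subseteq> {0..n} \<times> {0..n}"
    by (auto intro!: trans_le_add2 le)
  then show "finite {(i, j). 2 * i + m * j = n}"
    by (rule finite_subset) auto
  have coeff: "((2 * fps_X ^ 2 * geo m) ^ i) $ n =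
      (\<Sum>j\<in>{0..n}. if 2 * i + m * j = n then 2 ^ i * binom (int i + int j - 1) (int j) else 0)" for i
  proof -
    have "(2 * fps_X ^ 2 * geo m) ^ i = fps_const (2 ^ i) * (fps_X ^ (2 * i) * geo m ^ i)"
      by (simp add: power_mult_distrib power_mult mult.assoc numeral_fps_const flip: fps_const_power)
    then have "((2 * fps_X ^ 2 * geo m) ^ i) $ n = 2 ^ i * (if n < 2 * i then 0 else (geo m ^ i) $ (n - 2 * i))"
      by (simp add: fps_X_power_mult_nth)
    also have "\<dots> = (\<Sum>j\<in>{0..n}. if 2 * i + m * j = n then 2 ^ i * binom (int i + int j - 1) (int j) else 0)"
    proof (cases "2 * i \<le> n \<and> m dvd (n - 2 * i)")
      case True
      then obtain l where l: "n = 2 * i + m * l" by (metis dvdE le_add_diff_inverse)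
      have "l \<le> n" using l le[of l] by linarith
      then show ?thesis using l assms by (simp add: geo_power)
    next
      case False
      then have "2 * i + m * j \<noteq> n" for j by auto
      then show ?thesis using False by (auto simp: geo_power[OF assms])
    qed
    finally show ?thesis .
  qed
  have "(choose_series k oo (2 * fps_X ^ 2 * geo m)) $ n =
      (\<Sum>i\<in>{0..n}. \<Sum>j\<in>{0..n}. if 2 * i + m * j = n then ?c (i, j) else 0)"
    unfolding fps_compose_nth coeff choose_series_def sum_distrib_left
    by (intro sum.cong refl) (simp add: binom_int_int)
  also have "\<dots> = (\<Sum>z\<in>{0..n} \<times> {0..n}. if (case z of (i, j) \<Rightarrow> 2 * i + m * j = n) then ?c z else 0)"
    by (auto simp: sum.cartesian_product intro!: sum.cong)
  also have "\<dots> = sum ?c {(i, j). 2 * i + m * j = n}"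
    using sub by (simp add: sum.If_cases split_def Int_absorb1 subset_eq Int_def) (intro sum.cong; auto)
  finally show "(choose_series k oo (2 * fps_X ^ 2 * geo m)) $ n = sum ?c {(i, j). 2 * i + m * j = n}" .
qed auto

section \<open>Pairs of positive integers with prescribed difference\<close>

definition pairs :: "int set \<Rightarrow> (nat \<times> nat) set" where
  "pairs D = {(a, b). 0 < a \<and> 0 < b \<and> int a - int b \<in> D}"

lemma expansion_geo:
  assumes "0 < m"
  shows "expansion (geo m) UNIV (\<lambda>_. 1) (\<lambda>t. m * t)"
  by (rule expansionI[where T = "\<lambda>n. if m dvd n then {n div m} else {}"])
     (use assms in \<open>auto simp: geo_def split: if_splits\<close>)

text \<open>A pair of positive integers is determined by its minimum \<open>t + 1\<close> and its signed difference \<open>d\<close>, and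
its sum is \<open>2 + 2 t + \<bar>d\<bar>\<close>. Hence a condition on the difference alone contributes a factor of its
own, and the minimum contributes \<open>X^2 / (1 - X^2)\<close>.\<close>
lemma expansion_pairs:
  assumes "expansion f D (\<lambda>_. 1) (\<lambda>d. nat \<bar>d\<bar>)"
  shows "expansion (fps_X ^ 2 * (geo 2 * f)) (pairs D) (\<lambda>_. 1) (\<lambda>(a, b). a + b)"
proof -
  let ?S = "{()} \<times> (UNIV :: nat set) \<times> D"
  let ?h = "\<lambda>(u :: unit, t :: nat, d). (Suc (t + nat d), Suc (t + nat (- d)))"
  have "expansion (fps_X ^ 2 * (geo 2 * f)) (?h ` ?S) (\<lambda>_. 1) (\<lambda>(a, b). a + b)"
  proof (rule expansion_image)
    show "expansion (fps_X ^ 2 * (geo 2 * f)) ?S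
        (\<lambda>(u, z). 1 * (case z of (t, d) \<Rightarrow> 1 * 1)) (\<lambda>(u, z). 2 + (case z of (t, d) \<Rightarrow> 2 * t + nat \<bar>d\<bar>))"
      by (intro expansion_mult expansion_X_power expansion_geo assms) simp
    show "inj_on ?h ?S"
      by (auto simp: inj_on_def)
  qed auto
  also have "?h ` ?S = pairs D"
  proof
    show "?h ` ?S \<subseteq> pairs D" by (auto simp: pairs_def)
    show "pairs D \<subseteq> ?h ` ?S"
    proof
      fix z assume "z \<in> pairs D"
      then obtain a b where z: "z = (a, b)" "0 < a" "0 < b" "int a - int b \<in> D"
        by (auto simp: pairs_def)
      \<comment> \<open>The positive and the negative part of the difference are what \<open>a\<close> and \<open>b\<close> exceed the
        minimum by.\<close>
      then have "z = ?h ((), min a b - 1, int a - int b)" by auto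
      then show "z \<in> ?h ` ?S" using z by blast
    qed
  qed
  finally show ?thesis .
qed

lemma expansion_differences:
  "expansion (Abs_fps (\<lambda>n. int (card ({int n, - int n} \<inter> D)))) D (\<lambda>_. 1) (\<lambda>d. nat \<bar>d\<bar>)"
  by (rule expansionI[where T = "\<lambda>n. {int n, - int n} \<inter> D"]) auto

lemma expansion_multiples:
  "expansion (2 * geo m - 1) {d. int m dvd d} (\<lambda>_. 1) (\<lambda>d. nat \<bar>d\<bar>)"
proof -
  have "int (card ({int n, - int n} \<inter> {d. int m dvd d})) = (2 * geo m - 1) $ n" for n
    by (cases "n = 0"; cases "m dvd n") (auto simp: geo_def numeral_fps_const)
  then have "Abs_fps (\<lambda>n. int (card ({int n, - int n} \<inter> {d. int m dvd d}))) = 2 * geo m - 1"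
    by (simp add: fps_eq_iff)
  then show ?thesis
    using expansion_differences[of "{d. int m dvd d}"] by simp
qed

lemma expansion_nonmultiples:
  "expansion (2 * (geo 1 - geo m)) {d. \<not> int m dvd d} (\<lambda>_. 1) (\<lambda>d. nat \<bar>d\<bar>)"
proof -
  have "int (card ({int n, - int n} \<inter> {d. \<not> int m dvd d})) = (2 * (geo 1 - geo m)) $ n" for n
    by (cases "n = 0"; cases "m dvd n") (auto simp: geo_def numeral_fps_const)
  then have "Abs_fps (\<lambda>n. int (card ({int n, - int n} \<inter> {d. \<not> int m dvd d}))) = 2 * (geo 1 - geo m)"
    by (simp add: fps_eq_iff)
  then show ?thesis
    using expansion_differences[of "{d. \<not> int m dvd d}"] by simp
qed

section \<open>The multinomial theorem\<close>

lemma prod_list_fact_dvd: "prod_list (map fact is) dvd (fact (sum_list is) :: nat)"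
proof (induction "is")
  case (Cons i "is")
  then have "fact i * prod_list (map fact is) dvd fact i * (fact (sum_list is) :: nat)"
    by (rule mult_dvd_mono[OF dvd_refl])
  then show ?case
    using fact_fact_dvd_fact[of i "sum_list is", where 'a = nat] by (auto intro: dvd_trans)
qed simp

text \<open>The division in the definition is exact by \<open>prod_list_fact_dvd\<close>, so that cancelling the
factorials turns it into the product formula of binomial coefficients.\<close>
lemma multinomial_Cons:
  "multinomial (i + sum_list is) (i # is) = (i + sum_list is choose i) * multinomial (sum_list is) is"
proof -
  let ?s = "sum_list is" and ?p = "prod_list (map fact is) :: nat"
  have "?p dvd fact ?s" by (rule prod_list_fact_dvd)
  then have p: "fact ?s = ?p * multinomial ?s is"
    by (simp add: multinomial_def)
  have nz: "?p \<noteq> 0" by (auto simp: prod_list_zero_iff)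
  have "fact (i + ?s) = (fact i * fact ?s * (i + ?s choose i) :: nat)"
    using binomial_fact_lemma[of i "i + ?s"] by simp
  also have "\<dots> = (fact i * ?p) * ((i + ?s choose i) * multinomial ?s is)"
    by (simp add: p mult_ac)
  finally show ?thesis
    using nz by (simp add: multinomial_def)
qed

lemma finite_lists_sum: "finite {is :: nat list. length is = l \<and> sum_list is = k}"
  by (rule finite_subset[OF _ finite_lists_length_eq[of "{..k}" l]])
     (auto dest: member_le_sum_list)

text \<open>Induction on the summands: the binomial theorem splits off the first one, and the exponent lists
decompose accordingly into a head \<open>i\<close> and a tail of sum \<open>k - i\<close>.\<close>
lemma multinomial_theorem:
  fixes xs :: "'a::comm_semiring_1 list"
  shows "sum_list xs ^ k =
    (\<Sum>is | length is = length xs \<and> sum_list is = k.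
       of_nat (multinomial k is) * (\<Prod>t<length xs. xs ! t ^ (is ! t)))"
proof (induction xs arbitrary: k)
  case Nil
  have "{is :: nat list. is = [] \<and> sum_list is = k} = (if k = 0 then {[]} else {})" by auto
  then show ?case by (simp add: multinomial_def power_0_left)
next
  case (Cons x xs)
  let ?L = "\<lambda>j. {is :: nat list. length is = length xs \<and> sum_list is = j}"
  let ?P = "\<lambda>is. \<Prod>t<length xs. xs ! t ^ (is ! t)"
  have lists: "{is. length is = length (x # xs) \<and> sum_list is = k} =
      (\<lambda>(i, is). i # is) ` (SIGMA i:{..k}. ?L (k - i))" (is "?A = ?B")
  proof
    show "?A \<subseteq> ?B"
    proof
      fix js assume js: "js \<in> ?A"
      then obtain i "is" where "js = i # is" by (cases js) auto
      then show "js \<in> ?B" using js by (auto intro!: image_eqI[of _ _ "(i, is)"])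
    qed
  qed auto
  have "sum_list (x # xs) ^ k = (\<Sum>i\<le>k. of_nat (k choose i) * x ^ i * sum_list xs ^ (k - i))"
    by (simp add: binomial_ring)
  also have "\<dots> = (\<Sum>i\<le>k. \<Sum>is\<in>?L (k - i). of_nat (k choose i) * x ^ i * (of_nat (multinomial (k - i) is) * ?P is))"
    by (simp add: Cons.IH sum_distrib_left)
  also have "\<dots> = (\<Sum>(i, is)\<in>(SIGMA i:{..k}. ?L (k - i)).
      of_nat (k choose i) * x ^ i * (of_nat (multinomial (k - i) is) * ?P is))"
    by (rule sum.Sigma) (auto simp: finite_lists_sum)
  also have "\<dots> = (\<Sum>(i, is)\<in>(SIGMA i:{..k}. ?L (k - i)).
      of_nat (multinomial k (i # is)) * (\<Prod>t<length (x # xs). (x # xs) ! t ^ ((i # is) ! t)))"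
  proof (rule sum.cong[OF refl])
    fix z assume "z \<in> (SIGMA i:{..k}. ?L (k - i))"
    then obtain i "is" where z: "z = (i, is)" and i: "i \<le> k"
      and l: "length is = length xs" "sum_list is = k - i" by auto
    then have "multinomial k (i # is) = (k choose i) * multinomial (k - i) is"
      using multinomial_Cons[of i "is"] by simp
    then show "(case z of (i, is) \<Rightarrow>
          of_nat (k choose i) * x ^ i * (of_nat (multinomial (k - i) is) * ?P is)) =
        (case z of (i, is) \<Rightarrow>
          of_nat (multinomial k (i # is)) * (\<Prod>t<length (x # xs). (x # xs) ! t ^ ((i # is) ! t)))"
      by (simp add: z prod.lessThan_Suc_shift mult_ac del: prod.lessThan_Suc)
  qed
  also have "\<dots> = (\<Sum>is | length is = length (x # xs) \<and> sum_list is = k.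
       of_nat (multinomial k is) * (\<Prod>t<length (x # xs). (x # xs) ! t ^ (is ! t)))"
    unfolding lists by (subst sum.reindex) (auto simp: inj_on_def intro!: sum.cong)
  finally show ?case .
qed

lemma expansion_geometric_sum_power:
  "expansion ((\<Sum>t<l. fps_X ^ t) ^ k) {is. length is = l \<and> sum_list is = k}
     (\<lambda>is. int (multinomial k is)) (\<lambda>is. \<Sum>t<l. t * is ! t)"
    (is "expansion _ ?S ?c ?w")
proof (rule expansionI[where T = "\<lambda>n. {is \<in> ?S. ?w is = n}"])
  fix n
  show "finite {is \<in> ?S. ?w is = n}"
    by (rule finite_subset[OF _ finite_lists_sum[of l k]]) auto
  let ?xs = "map (\<lambda>t. fps_X ^ t :: int fps) [0..<l]"
  have "(\<Sum>t<l. fps_X ^ t) = sum_list ?xs"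
    by (simp add: interv_sum_list_conv_sum_set_nat atLeast0LessThan)
  then have "(\<Sum>t<l. fps_X ^ t) ^ k =
      (\<Sum>is\<in>?S. of_nat (multinomial k is) * (\<Prod>t<l. ?xs ! t ^ (is ! t)))"
    using multinomial_theorem[of ?xs k] by simp
  also have "\<dots> = (\<Sum>is\<in>?S. fps_const (?c is) * fps_X ^ ?w is)"
    by (intro sum.cong refl) (simp add: power_sum power_mult fps_of_nat)
  finally have "((\<Sum>t<l. fps_X ^ t) ^ k) $ n = (\<Sum>is\<in>?S. if ?w is = n then ?c is else 0)"
    by (auto simp: fps_sum_nth intro!: sum.cong)
  also have "\<dots> = (\<Sum>is | is \<in> ?S \<and> ?w is = n. ?c is)"
    by (rule sum.inter_filter[symmetric]) (rule finite_lists_sum)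
  finally show "((\<Sum>t<l. fps_X ^ t) ^ k) $ n = (\<Sum>is | is \<in> ?S \<and> ?w is = n. ?c is)" .
qed auto

section \<open>Removing the outer pair of parts\<close>

definition even_middle :: "nat list \<Rightarrow> bool" where
  "even_middle \<alpha> \<longleftrightarrow>
     even (length \<alpha>) \<or> (odd (length \<alpha>) \<and> even (\<alpha> ! ((length \<alpha> + 1) div 2 - 1)))"

definition pc_lists :: "nat \<Rightarrow> nat \<Rightarrow> nat list set" where
  "pc_lists m k = {\<alpha>. (\<forall>a\<in>set \<alpha>. 0 < a) \<and> card (mismatches m \<alpha>) = k \<and> even_middle \<alpha>}"

definition wrap :: "(nat \<times> nat) \<times> nat list \<Rightarrow> nat list" where
  "wrap = (\<lambda>((a, b), \<beta>). a # \<beta> @ [b])"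

lemma even_middle_wrap: "even_middle (wrap ((a, b), \<beta>)) \<longleftrightarrow> even_middle \<beta>"
proof (cases "even (length \<beta>)")
  case True
  then show ?thesis by (simp add: even_middle_def wrap_def)
next
  case False
  then obtain j where "length \<beta> = 2 * j + 1" by (auto elim: oddE)
  then show ?thesis by (simp add: even_middle_def wrap_def nth_append)
qed

text \<open>Wrapping moves position \<open>i\<close> to position \<open>i + 1\<close> and keeps mirror images facing each other.\<close>
lemma mismatches_wrap:
  "mismatches m (wrap ((a, b), \<beta>)) =
     (if [a = b] (mod m) then {} else {1}) \<union> Suc ` mismatches m \<beta>" (is "?A = ?B")
proof -
  have "i \<in> ?A \<longleftrightarrow> i \<in> ?B" for i
  proof (cases i)
    case 0
    then show ?thesis by (auto simp: mismatches_def)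
  next
    case (Suc j)
    show ?thesis
    proof (cases j)
      case 0
      then show ?thesis using Suc by (auto simp: mismatches_def wrap_def nth_append)
    next
      case (Suc l)
      have "(\<beta> @ [b]) ! l = \<beta> ! l" "(a # \<beta> @ [b]) ! (length \<beta> - l) = \<beta> ! (length \<beta> - Suc l)"
        if "2 * Suc l \<le> length \<beta>"
        using that by (auto simp: nth_append nth_Cons')
      then show ?thesis
        using Suc \<open>i = Suc j\<close> by (auto simp: mismatches_def wrap_def inj_image_mem_iff)
    qed
  qed
  then show ?thesis by blast
qed

lemma card_mismatches_wrap:
  "card (mismatches m (wrap ((a, b), \<beta>))) =
     card (mismatches m \<beta>) + (if [a = b] (mod m) then 0 else 1)"
proof -
  have "mismatches m \<beta> \<subseteq> {..length \<beta>}" by (auto simp: mismatches_def)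
  then have "finite (mismatches m \<beta>)" using finite_subset by blast
  moreover have "1 \<notin> Suc ` mismatches m \<beta>" by (auto simp: mismatches_def)
  ultimately show ?thesis by (simp add: mismatches_wrap card_image)
qed

lemma inj_wrap: "inj_on wrap S"
  by (auto simp: inj_on_def wrap_def)

lemma sum_list_wrap: "sum_list (wrap ((a, b), \<beta>)) = a + b + sum_list \<beta>"
  by (simp add: wrap_def)

lemma wrap_in_pc_lists:
  "wrap ((a, b), \<beta>) \<in> pc_lists m k \<longleftrightarrow> 0 < a \<and> 0 < b \<and>
     \<beta> \<in> pc_lists m (if [a = b] (mod m) then k else k - 1) \<and> ([a = b] (mod m) \<or> 0 < k)"
proof -
  have "(\<forall>x\<in>set (wrap ((a, b), \<beta>)). 0 < x) \<longleftrightarrow> 0 < a \<and> 0 < b \<and> (\<forall>x\<in>set \<beta>. 0 < x)"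
    by (auto simp: wrap_def)
  then show ?thesis
    unfolding pc_lists_def mem_Collect_eq card_mismatches_wrap even_middle_wrap
    by (cases "[a = b] (mod m)"; cases k) auto
qed

lemma list_cases_wrap:
  obtains "\<alpha> = []" | x where "\<alpha> = [x]" | a b \<beta> where "\<alpha> = wrap ((a, b), \<beta>)"
proof (cases \<alpha>)
  case (Cons a \<gamma>)
  then show ?thesis
    using that by (cases \<gamma> rule: rev_cases) (auto simp: wrap_def)
qed (use that in blast)

text \<open>What remains of a list with \<open>even_middle\<close> and positive entries when outer pairs are removed as long
as possible.\<close>
definition cores :: "nat list set" where
  "cores = {[]} \<union> {[x] |x. 0 < x \<and> even x}"

lemma short_in_pc_lists:
  "[] \<in> pc_lists m k \<longleftrightarrow> k = 0" "[x] \<in> pc_lists m k \<longleftrightarrow> k = 0 \<and> 0 < x \<and> even x"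
proof -
  have "mismatches m [] = {}" "mismatches m [x] = {}" by (auto simp: mismatches_def)
  then show "[] \<in> pc_lists m k \<longleftrightarrow> k = 0" "[x] \<in> pc_lists m k \<longleftrightarrow> k = 0 \<and> 0 < x \<and> even x"
    by (auto simp: pc_lists_def even_middle_def)
qed

lemma cong_iff_multiple: "[a = b] (mod m) \<longleftrightarrow> int m dvd int a - int b"
  by (metis cong_int_iff cong_iff_dvd_diff)

text \<open>A list without mismatches is a core or arises by wrapping a congruent pair around a shorter one.\<close>
lemma pc_lists_0: "pc_lists m 0 = cores \<union> wrap ` (pairs {d. int m dvd d} \<times> pc_lists m 0)"
  (is "?A = ?B")
proof -
  have "\<alpha> \<in> ?A \<longleftrightarrow> \<alpha> \<in> ?B" for \<alpha>
    by (cases \<alpha> rule: list_cases_wrap)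
       (auto simp: short_in_pc_lists cores_def wrap_in_pc_lists inj_image_mem_iff[OF inj_wrap]
          pairs_def cong_iff_multiple, auto simp: wrap_def)
  then show ?thesis by blast
qed

text \<open>No core has a mismatch; the outer pair either is congruent, leaving all \<open>k + 1\<close> mismatches to the
inside, or is itself one of them.\<close>
lemma pc_lists_Suc:
  "pc_lists m (Suc k) = wrap ` (pairs {d. int m dvd d} \<times> pc_lists m (Suc k))
     \<union> wrap ` (pairs {d. \<not> int m dvd d} \<times> pc_lists m k)"
  (is "?A = ?B")
proof -
  have "\<alpha> \<in> ?A \<longleftrightarrow> \<alpha> \<in> ?B" for \<alpha>
    by (cases \<alpha> rule: list_cases_wrap)
       (auto simp: short_in_pc_lists cores_def wrap_in_pc_lists inj_image_mem_iff[OF inj_wrap]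
          pairs_def cong_iff_multiple, auto simp: wrap_def)
  then show ?thesis by blast
qed

section \<open>Equations for the generating functions\<close>

definition pc_series :: "nat \<Rightarrow> nat \<Rightarrow> int fps" where
  "pc_series m k = Abs_fps (\<lambda>n. int (pc_plus k n m))"

lemma finite_compositions: "finite (compositions n)"
proof -
  have "length \<alpha> \<le> sum_list \<alpha>" if "\<forall>a\<in>set \<alpha>. 0 < a" for \<alpha> :: "nat list"
    using that by (induction \<alpha>) auto
  then have "compositions n \<subseteq> {\<alpha>. set \<alpha> \<subseteq> {..n} \<and> length \<alpha> \<le> n}"
    by (auto simp: compositions_def dest: member_le_sum_list)
  then show ?thesis
    by (rule finite_subset) (simp add: finite_lists_length_le)
qed

lemma expansion_pc_series: "expansion (pc_series m k) (pc_lists m k) (\<lambda>_. 1) sum_list"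
proof (rule expansionI[where T = "\<lambda>n. {\<alpha> \<in> pc_lists m k. sum_list \<alpha> = n}"])
  fix n
  show "finite {\<alpha> \<in> pc_lists m k. sum_list \<alpha> = n}"
    by (rule finite_subset[OF _ finite_compositions[of n]]) (auto simp: pc_lists_def compositions_def)
  have "{\<alpha> \<in> pc_lists m k. sum_list \<alpha> = n} =
    {\<alpha> \<in> compositions n. card (mismatches m \<alpha>) = k \<and>
       (even (length \<alpha>) \<or> (odd (length \<alpha>) \<and> even (\<alpha> ! ((length \<alpha> + 1) div 2 - 1))))}"
    by (auto simp: pc_lists_def compositions_def even_middle_def)
  then show "pc_series m k $ n = (\<Sum>\<alpha> | \<alpha> \<in> pc_lists m k \<and> sum_list \<alpha> = n. 1)"
    by (simp add: pc_series_def pc_plus_def)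
qed auto

lemma expansion_wrap:
  assumes f: "expansion f D (\<lambda>_. 1) (\<lambda>d. nat \<bar>d\<bar>)"
  shows "expansion (fps_X ^ 2 * (geo 2 * f) * pc_series m k)
     (wrap ` (pairs D \<times> pc_lists m k)) (\<lambda>_. 1) sum_list"
  by (rule expansion_image[OF expansion_mult[OF expansion_pairs[OF f] expansion_pc_series] inj_wrap])
     (auto simp: sum_list_wrap)

lemma expansion_cores: "expansion (geo 2) cores (\<lambda>_. 1) sum_list"
  by (rule expansionI[where T = "\<lambda>n. if even n then {if n = 0 then [] else [n]} else {}"])
     (auto simp: geo_def cores_def split: if_splits)

text \<open>The summand \<^term>\<open>geo 2\<close> counts the cores: there is exactly one of each even size.\<close>
lemma pc_series_0:
  "pc_series m 0 = geo 2 + fps_X ^ 2 * (geo 2 * (2 * geo m - 1)) * pc_series m 0"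
proof (rule expansion_unique[OF expansion_pc_series])
  show "expansion (geo 2 + fps_X ^ 2 * (geo 2 * (2 * geo m - 1)) * pc_series m 0)
      (pc_lists m 0) (\<lambda>_. 1) sum_list"
    by (subst pc_lists_0, intro expansion_Un expansion_cores expansion_wrap expansion_multiples)
       (auto simp: cores_def wrap_def)
qed

lemma pc_series_Suc:
  "pc_series m (Suc k) =
     fps_X ^ 2 * (geo 2 * (2 * geo m - 1)) * pc_series m (Suc k)
     + fps_X ^ 2 * (geo 2 * (2 * (geo 1 - geo m))) * pc_series m k"
proof (rule expansion_unique[OF expansion_pc_series])
  show "expansion (fps_X ^ 2 * (geo 2 * (2 * geo m - 1)) * pc_series m (Suc k)
     + fps_X ^ 2 * (geo 2 * (2 * (geo 1 - geo m))) * pc_series m k)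
      (pc_lists m (Suc k)) (\<lambda>_. 1) sum_list"
    by (subst pc_lists_Suc, intro expansion_Un expansion_wrap expansion_multiples expansion_nonmultiples)
       (auto simp: wrap_def pairs_def)
qed

text \<open>The recurrence reads \<open>F = E + E (b - X^2) F\<close> with \<open>E = 1 / (1 - X^2)\<close> and \<open>b = 2 X^2 / (1 - X^m)\<close>.
Multiplication by \<open>1 - X^2\<close> removes \<open>E\<close>, and the terms \<open>X^2 F\<close> cancel.\<close>
lemma pc_series_0_closed:
  "(1 - 2 * fps_X ^ 2 * geo m) * pc_series m 0 = 1"
proof -
  let ?F = "pc_series m 0"
  have e: "(1 - fps_X ^ 2) * geo 2 = 1" by (rule geo_inverse) simp
  have "(1 - fps_X ^ 2) * ?F = (1 - fps_X ^ 2) * geo 2 * (1 + fps_X ^ 2 * (2 * geo m - 1) * ?F)"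
    by (subst pc_series_0) (simp add: algebra_simps)
  then show ?thesis unfolding e by (simp add: algebra_simps)
qed

lemma one_minus_X_mult_geometric_sum: "(1 - fps_X) * (\<Sum>t<l. fps_X ^ t) = (1 - fps_X ^ l :: int fps)"
  using one_diff_power_eq[of "fps_X :: int fps" l] by simp

text \<open>The exponents that are not multiples of \<open>m\<close> are those of the form \<open>q m + 1 + t\<close> with \<open>t < m - 1\<close>.\<close>
lemma geo_1_minus_geo:
  assumes "0 < m"
  shows "geo 1 - geo m = geo m * (fps_X * (\<Sum>t<m - 1. fps_X ^ t))" (is "_ = geo m * (fps_X * ?H)")
proof -
  have "(1 - fps_X) * (1 + fps_X * ?H) = 1 - fps_X + fps_X * ((1 - fps_X) * ?H)"
    by (simp add: algebra_simps)
  also have "\<dots> = 1 - fps_X ^ m"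
    using assms unfolding one_minus_X_mult_geometric_sum
    by (cases m) (simp_all add: algebra_simps)
  finally have *: "1 - fps_X ^ m = (1 - fps_X) * (1 + fps_X * ?H)" ..
  have "geo 1 = geo 1 * ((1 - fps_X ^ m) * geo m)"
    using geo_inverse[OF assms] by simp
  also have "\<dots> = ((1 - fps_X ^ 1) * geo 1) * ((1 + fps_X * ?H) * geo m)"
    unfolding * by (simp add: mult_ac)
  also have "\<dots> = geo m + geo m * (fps_X * ?H)"
    by (subst geo_inverse) (simp_all add: algebra_simps)
  finally show ?thesis by simp
qed

lemma pc_series_Suc_reduced:
  assumes "0 < m"
  shows "(1 - 2 * fps_X ^ 2 * geo m) * pc_series m (Suc k) =
    2 * fps_X ^ 2 * geo m * (fps_X * (\<Sum>t<m - 1. fps_X ^ t)) * pc_series m k"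
proof -
  let ?F = "pc_series m (Suc k)"
  have e: "(1 - fps_X ^ 2) * geo 2 = 1" by (rule geo_inverse) simp
  have "(1 - fps_X ^ 2) * ?F = (1 - fps_X ^ 2) * geo 2 *
      (fps_X ^ 2 * (2 * geo m - 1) * ?F + fps_X ^ 2 * (2 * (geo 1 - geo m)) * pc_series m k)"
    by (subst pc_series_Suc) (simp add: algebra_simps)
  then show ?thesis unfolding e geo_1_minus_geo[OF assms] by (simp add: algebra_simps)
qed

text \<open>With \<open>H = 1 + X + \<dots> + X^(m - 2)\<close>, each further mismatch multiplies the series by
\<open>X H b / (1 - b)\<close>. The powers of \<open>X H\<close> split off, and what remains, \<open>b^k / (1 - b)^(k + 1)\<close>, is the
series of binomial coefficients at \<open>b\<close>.\<close>
lemma pc_series_closed_form: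
  assumes "0 < m"
  shows "pc_series m k =
    fps_X ^ k * ((choose_series k oo (2 * fps_X ^ 2 * geo m)) * (\<Sum>t<m - 1. fps_X ^ t) ^ k)"
proof (induction k)
  define b where "b = 2 * fps_X ^ 2 * geo m"
  define H :: "int fps" where "H = (\<Sum>t<m - 1. fps_X ^ t)"
  have b0: "b $ 0 = 0" by (simp add: b_def)
  have "1 - b \<noteq> 0" using b0 by (metis diff_zero fps_one_nth fps_sub_nth fps_zero_nth zero_neq_one)
  then have cancel: "f = g" if "(1 - b) * f = (1 - b) * g" for f g
    using that by simp
  have X: "(1 - fps_X) oo b = 1 - b"
    using b0 by (simp add: fps_compose_sub_distrib)
  {
    case 0
    have "(1 - b) * (choose_series 0 oo b) = 1"
      using arg_cong[OF choose_series_0, of "\<lambda>f. f oo b"] by (simp add: fps_compose_mult_distrib b0 X)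
    then have "pc_series m 0 = choose_series 0 oo b"
      by - (rule cancel[of "pc_series m 0"], simp only: pc_series_0_closed[of m, folded b_def])
    then show ?case
      unfolding b_def by simp
  next
    case (Suc k)
    have step: "(1 - b) * (choose_series (Suc k) oo b) = b * (choose_series k oo b)"
      using arg_cong[OF choose_series_Suc, of "\<lambda>f. f oo b" k]
      by (simp add: fps_compose_mult_distrib b0 X)
    have "(1 - b) * pc_series m (Suc k) = b * (fps_X * H) * (fps_X ^ k * ((choose_series k oo b) * H ^ k))"
      using pc_series_Suc_reduced[OF assms, of k] Suc.IH unfolding b_def H_def by simp
    also have "\<dots> = (b * (choose_series k oo b)) * (fps_X ^ Suc k * H ^ Suc k)"
      by (simp add: mult_ac)
    also have "\<dots> = (1 - b) * (fps_X ^ Suc k * ((choose_series (Suc k) oo b) * H ^ Suc k))"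
      unfolding step[symmetric] by (simp only: mult_ac)
    finally show ?case
      unfolding b_def[symmetric] H_def[symmetric] by (rule cancel)
  }
qed

text \<open>The first formula of the theorem uses this closed form of \<open>H^k\<close>, the second one the multinomial
theorem.\<close>
lemma geometric_sum_power:
  "(\<Sum>t<l. fps_X ^ t) ^ k = (1 - fps_X ^ l) ^ k * geo 1 ^ k"
proof -
  have "(\<Sum>t<l. fps_X ^ t) = ((1 - fps_X ^ 1) * geo 1) * (\<Sum>t<l. fps_X ^ t)"
    by (subst geo_inverse) simp_all
  also have "\<dots> = ((1 - fps_X) * (\<Sum>t<l. fps_X ^ t)) * geo 1"
    by (simp only: mult_ac power_one_right)
  finally show ?thesis
    by (simp only: one_minus_X_mult_geometric_sum power_mult_distrib)
qed

section \<open>Extraction of coefficients\<close>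

text \<open>Both formulas of the theorem are instances: they differ only in how the power of the geometric sum
is expanded. For \<open>n < k\<close> the index set is empty, matching the factor \<open>X^k\<close>.\<close>
lemma pc_plus_eq_sum:
  assumes m: "0 < m"
    and H: "expansion ((\<Sum>t<m - 1. fps_X ^ t) ^ k) S c w"
  shows "int (pc_plus k n m) =
    sum' (\<lambda>((i, j), x). 2 ^ i * binom (int i) (int k) * binom (int i + int j - 1) (int j) * c x)
      {((i, j), x). x \<in> S \<and> k + (2 * i + m * j + w x) = n}"
proof -
  have "int (pc_plus k n m) = pc_series m k $ n"
    by (simp add: pc_series_def)
  also have "\<dots> = sum' (\<lambda>(z, x). (\<lambda>(i, j). 2 ^ i * binom (int i) (int k) * binom (int i + int j - 1) (int j)) z * c x)
      {y \<in> UNIV \<times> S. k + (\<lambda>(z, x). (\<lambda>(i, j). 2 * i + m * j) z + w x) y = n}"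
  proof -
    note e = expansion_mult[OF expansion_choose_series_compose[OF m, of k] H]
    show ?thesis
    proof (cases "k \<le> n")
      case True
      then have "{y \<in> UNIV \<times> S. k + (\<lambda>(z, x). (\<lambda>(i, j). 2 * i + m * j) z + w x) y = n} =
        {y \<in> UNIV \<times> S. (\<lambda>(z, x). (\<lambda>(i, j). 2 * i + m * j) z + w x) y = n - k}"
        by auto
      then show ?thesis
        using True by (simp only: expansion_nth[OF e] pc_series_closed_form[OF m] fps_X_power_mult_nth) simp
    next
      case False
      then have "{y \<in> UNIV \<times> S. k + (\<lambda>(z, x). (\<lambda>(i, j). 2 * i + m * j) z + w x) y = n} = {}"
        by auto
      then show ?thesis
        using False by (simp only: pc_series_closed_form[OF m] fps_X_power_mult_nth) simp
    qed
  qed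
  also have "\<dots> = sum' (\<lambda>((i, j), x). 2 ^ i * binom (int i) (int k) * binom (int i + int j - 1) (int j) * c x)
      {((i, j), x). x \<in> S \<and> k + (2 * i + m * j + w x) = n}"
    by (intro sum.cong') auto
  finally show ?thesis .
qed

lemma sum'_reindex:
  assumes inj: "inj_on h S" and eq: "\<And>x. x \<in> S \<Longrightarrow> c' (h x) = c x"
  shows "sum' c S = sum' c' (h ` S)"
proof -
  have supp: "{y \<in> h ` S. c' y \<noteq> 0} = h ` {x \<in> S. c x \<noteq> 0}"
    using eq by auto
  have "inj_on h {x \<in> S. c x \<noteq> 0}"
    using inj by (rule inj_on_subset) auto
  then show ?thesis
    using eq unfolding sum.G_def supp by (auto simp: finite_image_iff sum.reindex intro!: sum.cong)
qed

theorem theorem4p1: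
  fixes m n k :: nat
  assumes "0 < m"
  shows "(int (pc_plus k n m) =
      sum' (\<lambda>(i, j, r, s). (-1) ^ r * 2 ^ i * binom (int i) (int k)
                * binom (int i + int j - 1) (int j) * binom (int k) (int r)
                * binom (int k + int s - 1) (int s))
        {(i :: nat, j :: nat, r :: nat, s :: nat).
           2 * int i + int m * int j + (int m - 1) * int r + int s = int n - int k})
    \<and> (int (pc_plus k n m) =
      sum' (\<lambda>(i, j, is). 2 ^ i * binom (int i) (int k)
                * binom (int i + int j - 1) (int j) * int (multinomial k is))
        {(i :: nat, j :: nat, is :: nat list).
           length is = m - 1 \<and> sum_list is = k \<and>
           2 * int i + int m * int j + (\<Sum>t<m - 1. int t * int (is ! t)) = int n - int k})"
    (is "_ = sum' ?c1 ?S1 \<and> _ = sum' ?c2 ?S2")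
proof
  let ?h = "\<lambda>((i, j), x). (i, j, x)"
  have inj: "inj_on ?h A" for A by (auto simp: inj_on_def)
  have idx: "k + (2 * i + m * j + e) = n \<longleftrightarrow> 2 * int i + int m * int j + int e = int n - int k" for i j e
  proof -
    have "k + (2 * i + m * j + e) = n \<longleftrightarrow> int (k + (2 * i + m * j + e)) = int n"
      by (simp only: of_nat_eq_iff)
    then show ?thesis by (simp add: algebra_simps)
  qed
  have img: "?h ` {((i, j), x). x \<in> S \<and> k + (2 * i + m * j + w x) = n} =
      {(i, j, x). x \<in> S \<and> 2 * int i + int m * int j + int (w x) = int n - int k}" for S w
    unfolding idx by (auto simp: image_iff)
  have "expansion ((\<Sum>t<m - 1. fps_X ^ t) ^ k) (UNIV \<times> UNIV)
     (\<lambda>(r, s). (- 1) ^ r * binom (int k) (int r) * binom (int k + int s - 1) (int s))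
     (\<lambda>(r, s). (m - 1) * r + 1 * s)"
    unfolding geometric_sum_power
    by (intro expansion_mult expansion_one_minus_power expansion_geo_power) simp
  note * = pc_plus_eq_sum[OF assms this, where n = n]
  show "int (pc_plus k n m) = sum' ?c1 ?S1"
    unfolding * using assms
    by (subst sum'_reindex[OF inj, where c' = ?c1])
       (auto simp only: img, auto intro!: sum.cong' simp: of_nat_diff add.assoc)
  show "int (pc_plus k n m) = sum' ?c2 ?S2"
    unfolding pc_plus_eq_sum[OF assms expansion_geometric_sum_power, where k = k and n = n]
    by (subst sum'_reindex[OF inj, where c' = ?c2])
       (auto simp only: img, auto intro!: sum.cong')
qed

end
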